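(* The function $\eta$ is a metric on $\mathcal{E}(S,\mathcal{T})_1$; that is, on $\mathcal{E}(S,\mathcal{T})_1$ it takes values in $[0,\infty)$, $\eta(A,B)=0$ if and only if $A=B$, and $\eta(A,B)+\eta(B,D)\ge\eta(A,D)$ for all $A,B,D$ (symmetry is not required).
   Context: $\mathbb{R}_+^*$ denotes the set of positive reals. Let $S$ be a compact surface, possibly with boundary, and $\mathcal{T}$ a finite triangulation of $S$ with set of edges $E(\mathcal{T})=\{e_i\}$. Fix a set $\mathcal{J}$ of ordered triples $(i,j,k)$ of edge indices such that: (1) for each $(i,j,k)\in\mathcal{J}$, $e_i,e_j,e_k$ are the edges of a face of $\mathcal{T}$; (2) if a face has edges $e_i,e_j,e_k$, some permutation of $(i,j,k)$ is in $\mathcal{J}$; (3) if $(i,j,k)\in\mathcal{J}$, no odd permutation of it is in $\mathcal{J}$; (4) if $(i,j,k)\in\mathcal{J}$, all even permutations of it are in $\mathcal{J}$. $\mathcal{E}(S,\mathcal{T})$ is the set of singular Euclidean metrics $\mu$ on $S$ adapted to $\mathcal{T}$ (each face is a Euclidean triangle; the metric is locally Euclidean except perhaps at the vertices); such $\mu$ is determined by its edge lengths $l_\mu(e_i)>0$, which are arbitrary subject to the strict triangle inequalities for each face. It is identified with its image in $(\mathbb{R}_+^* )^{\mathcal{J}}$ under the injective map $\mu\mapsto(A_{ijk})$, $A_{ijk}=\frac{l_\mu(e_j)+l_\mu(e_k)-l_\mu(e_i)}{2}$. This image is the set of $(A_{ijk})\in(\mathbb{R}_+^* )^{\mathcal{J}}$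 with $A_{jki}+A_{kij}=A_{j'k'i}+A_{k'ij'}$ whenever $(i,j,k),(i,j',k')\in\mathcal{J}$ with $j\ne j'$, $k\neq k'$ (both sides equal the length of the interior edge $e_i$). $\mathrm{Ar}(A)$ is the area of the singular flat metric corresponding to $A$, i.e. the sum over the faces of $\mathcal{T}$ (with edges $e_i,e_j,e_k$, $(i,j,k)\in\mathcal{J}$) of $\sqrt{(A_{ijk}+A_{jki}+A_{kij})A_{ijk}A_{jki}A_{kij}}$. Set $\mathcal{E}(S,\mathcal{T})_1=\{A\in\mathcal{E}(S,\mathcal{T}):\mathrm{Ar}(A)=1\}$. For $A=(A_{ijk})$ and $B=(B_{ijk})$ in $\mathcal{E}(S,\mathcal{T})$, $\eta(A,B)=\log\max_{(i,j,k)\in\mathcal{J}}\frac{B_{ijk}}{A_{ijk}}$. *)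

theory Defs
  imports "HOL-Analysis.Analysis" "HOL-Library.Multiset"
begin

definition compact_surface :: "'a topology \<Rightarrow> bool" where
  "compact_surface S \<longleftrightarrow>
     compact_space S \<and> Hausdorff_space S \<and> second_countable S \<and>
     (\<forall>x \<in> topspace S. \<exists>U V. openin S U \<and> x \<in> U \<and>
        openin (top_of_set {z::complex. 0 \<le> Im z}) V \<and>
        subtopology S U homeomorphic_space top_of_set V)"

text \<open>
  A triangulation is given by its faces, and a face by its characteristic map, a map
  from a fixed closed triangle of the plane into the surface. Only the open cells are
  required to be embedded, so different vertices, or different edges, of a triangle may be
  identified with each other, and two faces may share several edges. Simplicial
  triangulations are a special case.
\<close>

definition std_triangle :: "complex set" where
  "std_triangle = convex hull {0, 1, \<i>}"

definition std_sides :: "(complex \<times> complex) set" where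
  "std_sides = {(0, 1), (1, \<i>), (\<i>, 0)}"

definition vertices :: "(complex \<Rightarrow> 'a) set \<Rightarrow> 'a set" where
  "vertices T = (\<Union>f\<in>T. f ` {0, 1, \<i>})"

definition open_edges :: "(complex \<Rightarrow> 'a) set \<Rightarrow> 'a set set" where
  "open_edges T = {f ` open_segment p q | f p q. f \<in> T \<and> (p, q) \<in> std_sides}"

definition face_edges :: "(complex \<Rightarrow> 'a) \<Rightarrow> 'a set multiset" where
  "face_edges f = {# f ` closed_segment 0 1, f ` closed_segment 1 \<i>, f ` closed_segment \<i> 0 #}"

definition edges :: "(complex \<Rightarrow> 'a) set \<Rightarrow> 'a set set" where
  "edges T = (\<Union>f\<in>T. set_mset (face_edges f))"

text \<open>
  The last five conditions say that the open faces, the open edges and the vertices are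
  pairwise disjoint, except that an open edge or a vertex may be the image of several sides
  or corners. As \<open>S\<close> is Hausdorff and \<open>T\<close> is finite, \<open>S\<close> then
  carries the quotient topology of the disjoint union of the triangles.
\<close>

definition surface_triangulation :: "'a topology \<Rightarrow> (complex \<Rightarrow> 'a) set \<Rightarrow> bool" where
  "surface_triangulation S T \<longleftrightarrow>
     finite T \<and>
     (\<forall>f\<in>T. continuous_map (top_of_set std_triangle) S f) \<and>
     (\<Union>f\<in>T. f ` std_triangle) = topspace S \<and>
     (\<forall>f\<in>T. inj_on f (interior std_triangle) \<and>
              (\<forall>(p, q) \<in> std_sides. inj_on f (open_segment p q))) \<and>
     (\<forall>f\<in>T. \<forall>g\<in>T. f \<noteq> g \<longrightarrow> disjnt (f ` interior std_triangle) (g ` interior std_triangle)) \<and>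
     (\<forall>f\<in>T. \<forall>g\<in>T. disjnt (f ` interior std_triangle) (g ` frontier std_triangle)) \<and>
     pairwise disjnt (open_edges T) \<and>
     (\<forall>a \<in> open_edges T. disjnt a (vertices T))"

text \<open>
  Here \<open>e\<close> enumerates the edges by the index set \<open>I\<close>. Together, the third and fourth conditions force the
  three edges of every face to be distinct.
\<close>

definition edge_triples ::
  "(complex \<Rightarrow> 'a) set \<Rightarrow> ('i \<Rightarrow> 'a set) \<Rightarrow> 'i set \<Rightarrow> ('i \<times> 'i \<times> 'i) set \<Rightarrow> bool" where
  "edge_triples T e I J \<longleftrightarrow>
     J \<subseteq> I \<times> I \<times> I \<and>
     (\<forall>(i, j, k) \<in> J. \<exists>f\<in>T. face_edges f = {# e i, e j, e k #}) \<and>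
     (\<forall>f\<in>T. \<forall>i\<in>I. \<forall>j\<in>I. \<forall>k\<in>I. face_edges f = {# e i, e j, e k #} \<longrightarrow>
        (\<exists>(i', j', k') \<in> J. {# i', j', k' #} = {# i, j, k #})) \<and>
     (\<forall>(i, j, k) \<in> J. (j, i, k) \<notin> J \<and> (i, k, j) \<notin> J \<and> (k, j, i) \<notin> J) \<and>
     (\<forall>(i, j, k) \<in> J. (j, k, i) \<in> J \<and> (k, i, j) \<in> J)"

text \<open>
  A singular Euclidean metric adapted to \<open>T\<close> is represented by its edge lengths, which
  determine it and are subject only to the strict triangle inequalities. In the definition,
  the edges of the face are matched with \<open>a\<close>, \<open>b\<close>, \<open>c\<close> in every order.
\<close>

definition adapted_metrics :: "(complex \<Rightarrow> 'a) set \<Rightarrow> ('a set \<Rightarrow> real) set" where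
  "adapted_metrics T =
     {l \<in> edges T \<rightarrow>\<^sub>E {0<..}.
        \<forall>f\<in>T. \<forall>a b c. face_edges f = {# a, b, c #} \<longrightarrow> l a < l b + l c}"

definition A_coord ::
  "('i \<Rightarrow> 'a set) \<Rightarrow> ('i \<times> 'i \<times> 'i) set \<Rightarrow> ('a set \<Rightarrow> real) \<Rightarrow> ('i \<times> 'i \<times> 'i \<Rightarrow> real)" where
  "A_coord e J l = (\<lambda>(i, j, k) \<in> J. (l (e j) + l (e k) - l (e i)) / 2)"

definition Euc ::
  "(complex \<Rightarrow> 'a) set \<Rightarrow> ('i \<Rightarrow> 'a set) \<Rightarrow> ('i \<times> 'i \<times> 'i) set \<Rightarrow> ('i \<times> 'i \<times> 'i \<Rightarrow> real) set" where
  "Euc T e J = A_coord e J ` adapted_metrics T"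

text \<open>
  The triple chosen for a face is unique up to even permutations, under which the area of
  the face is invariant; see \<open>face_area_eq\<close>.
\<close>

definition face_area ::
  "('i \<Rightarrow> 'a set) \<Rightarrow> ('i \<times> 'i \<times> 'i) set \<Rightarrow> ('i \<times> 'i \<times> 'i \<Rightarrow> real) \<Rightarrow> (complex \<Rightarrow> 'a) \<Rightarrow> real" where
  "face_area e J A f =
     (case (SOME (i, j, k). (i, j, k) \<in> J \<and> face_edges f = {# e i, e j, e k #}) of
        (i, j, k) \<Rightarrow> sqrt ((A (i, j, k) + A (j, k, i) + A (k, i, j))
                           * A (i, j, k) * A (j, k, i) * A (k, i, j)))"

definition Ar ::
  "(complex \<Rightarrow> 'a) set \<Rightarrow> ('i \<Rightarrow> 'a set) \<Rightarrow> ('i \<times> 'i \<times> 'i) set \<Rightarrow> ('i \<times> 'i \<times> 'i \<Rightarrow> real) \<Rightarrow> real" where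
  "Ar T e J A = (\<Sum>f\<in>T. face_area e J A f)"

definition Euc1 ::
  "(complex \<Rightarrow> 'a) set \<Rightarrow> ('i \<Rightarrow> 'a set) \<Rightarrow> ('i \<times> 'i \<times> 'i) set \<Rightarrow> ('i \<times> 'i \<times> 'i \<Rightarrow> real) set" where
  "Euc1 T e J = {A \<in> Euc T e J. Ar T e J A = 1}"

definition eta ::
  "('i \<times> 'i \<times> 'i) set \<Rightarrow> ('i \<times> 'i \<times> 'i \<Rightarrow> real) \<Rightarrow> ('i \<times> 'i \<times> 'i \<Rightarrow> real) \<Rightarrow> real" where
  "eta J A B = ln (Max ((\<lambda>t. B t / A t) ` J))"

lemma mset3_cases:
  assumes "{# a, b, c #} = {# x, y, z #}"
  shows "(a, b, c) \<in> {(x,y,z), (y,z,x), (z,x,y), (y,x,z), (x,z,y), (z,y,x)}"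
  using assms by (auto simp: add_eq_conv_diff add_mset_eq_single split: if_splits)

lemma triple_perm:
  assumes J: "edge_triples T e I J" and e: "inj_on e I"
    and t: "(i, j, k) \<in> J" "(i', j', k') \<in> J" "{# e i, e j, e k #} = {# e i', e j', e k' #}"
  shows "(i', j', k') \<in> {(i,j,k), (j,k,i), (k,i,j)}"
proof -
  have I: "i \<in> I" "j \<in> I" "k \<in> I" "i' \<in> I" "j' \<in> I" "k' \<in> I"
    using J t(1,2) by (auto simp: edge_triples_def)
  have odd: "(j, i, k) \<notin> J" "(i, k, j) \<notin> J" "(k, j, i) \<notin> J"
    using J t(1) by (auto simp: edge_triples_def)
  show ?thesis
    using mset3_cases[OF t(3)[symmetric]] I odd t(2) e by (auto simp: inj_on_eq_iff)
qed

lemma face_area_eq: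
  assumes J: "edge_triples T e I J" and e: "inj_on e I"
    and t: "(i, j, k) \<in> J" "face_edges f = {# e i, e j, e k #}"
  shows "face_area e J A f = sqrt ((A (i, j, k) + A (j, k, i) + A (k, i, j))
                                  * A (i, j, k) * A (j, k, i) * A (k, i, j))"
proof -
  define P where "P = (\<lambda>(i, j, k). (i, j, k) \<in> J \<and> face_edges f = {# e i, e j, e k #})"
  obtain i' j' k' where s: "(SOME t. P t) = (i', j', k')" by (cases "SOME t. P t")
  have "P (i, j, k)" using t by (simp add: P_def)
  then have "P (i', j', k')" using s by (metis someI)
  then have "(i', j', k') \<in> {(i,j,k), (j,k,i), (k,i,j)}"
    using triple_perm[OF J e t(1)] t(2) by (simp add: P_def)
  then show ?thesis
    using s unfolding face_area_def P_def[symmetric] by (auto simp: algebra_simps)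
qed

lemma face_of_triple:
  assumes "edge_triples T e I J" "(i, j, k) \<in> J"
  obtains f where "f \<in> T" "face_edges f = {# e i, e j, e k #}"
proof -
  have "\<forall>(i, j, k) \<in> J. \<exists>f\<in>T. face_edges f = {# e i, e j, e k #}"
    using assms(1) unfolding edge_triples_def by (elim conjE)
  from bspec[OF this assms(2)] show ?thesis using that by auto
qed

lemma triple_of_face:
  assumes "edge_triples T e I J" "f \<in> T" "p \<in> I" "q \<in> I" "r \<in> I"
    and "face_edges f = {# e p, e q, e r #}"
  obtains p' q' r' where "(p', q', r') \<in> J" "{# p', q', r' #} = {# p, q, r #}"
proof -
  have "\<forall>f\<in>T. \<forall>i\<in>I. \<forall>j\<in>I. \<forall>k\<in>I. face_edges f = {# e i, e j, e k #} \<longrightarrow>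
        (\<exists>(i', j', k') \<in> J. {# i', j', k' #} = {# i, j, k #})"
    using assms(1) unfolding edge_triples_def by (elim conjE)
  then have "\<exists>(i', j', k') \<in> J. {# i', j', k' #} = {# p, q, r #}"
    using assms(2-6) by blast
  then show ?thesis using that by (elim bexE) (simp split: prod.splits)
qed

lemma edge_in_triple:
  assumes e: "bij_betw e I (edges T)" and J: "edge_triples T e I J" and i: "i \<in> I"
  shows "\<exists>j k. (i, j, k) \<in> J"
proof -
  have "e i \<in> edges T" using e i by (auto simp: bij_betw_def)
  then obtain f where f: "f \<in> T" "e i \<in># face_edges f" by (auto simp: edges_def)
  obtain a b c where abc: "face_edges f = {# a, b, c #}" by (auto simp: face_edges_def)
  have "a \<in> edges T" "b \<in> edges T" "c \<in> edges T"
    using abc f(1) unfolding edges_def by force+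
  then obtain p q r where pqr: "p \<in> I" "q \<in> I" "r \<in> I" "a = e p" "b = e q" "c = e r"
    using e unfolding bij_betw_def by (metis imageE)
  then obtain p' q' r' where J': "(p', q', r') \<in> J" "{# p', q', r' #} = {# p, q, r #}"
    using triple_of_face[OF J f(1)] abc by metis
  have "i \<in> {p, q, r}"
    using f(2) abc pqr e i by (auto simp: bij_betw_def inj_on_eq_iff)
  then have "i \<in># {# p', q', r' #}" using J'(2) by auto
  moreover have "(q', r', p') \<in> J" "(r', p', q') \<in> J"
    using J J'(1) by (auto simp: edge_triples_def)
  ultimately show ?thesis using J'(1) by auto
qed

lemma A_coord_sum:
  assumes "edge_triples T e I J" "(i, j, k) \<in> J"
  shows "A_coord e J l (j, k, i) + A_coord e J l (k, i, j) = l (e i)"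
proof -
  have "(j, k, i) \<in> J" "(k, i, j) \<in> J" using assms by (auto simp: edge_triples_def)
  then show ?thesis by (simp add: A_coord_def field_simps)
qed

lemma inj_on_A_coord:
  assumes "bij_betw e I (edges T)" "edge_triples T e I J"
  shows "inj_on (A_coord e J) (adapted_metrics T)"
proof (rule inj_onI)
  fix l m assume lm: "l \<in> adapted_metrics T" "m \<in> adapted_metrics T"
    and eq: "A_coord e J l = A_coord e J m"
  have "l a = m a" if a: "a \<in> edges T" for a
  proof -
    obtain i where i: "i \<in> I" "a = e i" using assms(1) a by (auto simp: bij_betw_def)
    then obtain j k where "(i, j, k) \<in> J" using edge_in_triple[OF assms] by blast
    then show ?thesis using A_coord_sum[OF assms(2)] eq i(2) by metis
  qed
  then show "l = m" using lm by (auto simp: adapted_metrics_def intro: PiE_ext)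
qed

text \<open>
  The description of the image of \<open>A_coord\<close> by equations. The assumption on \<open>J\<close>
  holds if two different faces share at most one edge, as in a simplicial triangulation.
\<close>

lemma Euc_eq:
  assumes e: "bij_betw e I (edges T)" and J: "edge_triples T e I J"
    and share: "\<And>i j k j' k'. (i, j, k) \<in> J \<Longrightarrow> (i, j', k') \<in> J \<Longrightarrow> j = j' \<longleftrightarrow> k = k'"
  shows "Euc T e J =
    {A \<in> J \<rightarrow>\<^sub>E {0<..}. \<forall>i j k j' k'.
       (i, j, k) \<in> J \<and> (i, j', k') \<in> J \<and> j \<noteq> j' \<and> k \<noteq> k' \<longrightarrow>
       A (j, k, i) + A (k, i, j) = A (j', k', i) + A (k', i, j')}"
    (is "_ = ?R")
proof (intro subset_antisym subsetI)
  fix A assume "A \<in> Euc T e J"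
  then obtain l where l: "l \<in> adapted_metrics T" "A = A_coord e J l" by (auto simp: Euc_def)
  have "0 < A (i, j, k)" if t: "(i, j, k) \<in> J" for i j k
  proof -
    obtain f where f: "f \<in> T" "face_edges f = {# e i, e j, e k #}"
      using face_of_triple[OF J t] by metis
    then have "l (e i) < l (e j) + l (e k)" using l(1) unfolding adapted_metrics_def by blast
    then show ?thesis using t by (simp add: l(2) A_coord_def)
  qed
  then have "A \<in> J \<rightarrow>\<^sub>E {0<..}" using l(2) by (auto simp: A_coord_def)
  moreover have "A (j, k, i) + A (k, i, j) = A (j', k', i) + A (k', i, j')"
    if "(i, j, k) \<in> J" "(i, j', k') \<in> J" for i j k j' k'
    using A_coord_sum[OF J] that l(2) by simp
  ultimately show "A \<in> ?R" by blast
next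
  fix A assume A: "A \<in> ?R"
  define h where "h = (\<lambda>i. let (j, k) = (SOME (j, k). (i, j, k) \<in> J) in A (j, k, i) + A (k, i, j))"
  have h: "h i = A (j, k, i) + A (k, i, j)" if t: "(i, j, k) \<in> J" for i j k
  proof -
    obtain j' k' where s: "(SOME (j, k). (i, j, k) \<in> J) = (j', k')" by fastforce
    have "case (j', k') of (j, k) \<Rightarrow> (i, j, k) \<in> J"
      using someI[of "\<lambda>(j, k). (i, j, k) \<in> J" "(j, k)"] t unfolding s by simp
    then have t': "(i, j', k') \<in> J" by simp
    have "A (j', k', i) + A (k', i, j') = A (j, k, i) + A (k, i, j)"
    proof (cases "j = j'")
      case True
      then show ?thesis using share[OF t t'] by simp
    next
      case False
      then show ?thesis using share[OF t t'] t t' A by auto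
    qed
    then show ?thesis by (simp add: h_def s)
  qed
  define l where "l = (\<lambda>a \<in> edges T. h (the_inv_into I e a))"
  have le: "l (e i) = h i" if "i \<in> I" for i
    using e that by (auto simp: l_def bij_betw_def the_inv_into_f_f)
  have cyc: "(j, k, i) \<in> J" "(k, i, j) \<in> J" "i \<in> I" "j \<in> I" "k \<in> I" if "(i, j, k) \<in> J" for i j k
    using J that by (auto simp: edge_triples_def)
  have pos: "0 < A t" if "t \<in> J" for t using A that by auto
  have "l \<in> edges T \<rightarrow>\<^sub>E {0<..}"
  proof
    fix a assume "a \<in> edges T"
    then obtain i where i: "i \<in> I" "a = e i" using e by (auto simp: bij_betw_def)
    then obtain j k where t: "(i, j, k) \<in> J" using edge_in_triple[OF e J] by blast
    then show "l a \<in> {0<..}" using le[OF i(1)] i(2) h[OF t] pos cyc[OF t] by (simp add: add_pos_pos)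
  qed (simp add: l_def)
  moreover have "l a < l b + l c" if f: "f \<in> T" "face_edges f = {# a, b, c #}" for f a b c
  proof -
    have "a \<in> edges T" "b \<in> edges T" "c \<in> edges T"
      using f unfolding edges_def by force+
    then obtain p q r where pqr: "p \<in> I" "q \<in> I" "r \<in> I" "a = e p" "b = e q" "c = e r"
      using e unfolding bij_betw_def by (metis imageE)
    then obtain p' q' r' where t: "(p', q', r') \<in> J" and m: "{# p', q', r' #} = {# p, q, r #}"
      using triple_of_face[OF J f(1)] f(2) by metis
    note t' = cyc[OF t]
    show ?thesis
      using mset3_cases[OF m] pqr le h[OF t] h[OF t'(1)] h[OF t'(2)]
        pos[OF t] pos[OF t'(1)] pos[OF t'(2)] by auto
  qed
  ultimately have lT: "l \<in> adapted_metrics T" unfolding adapted_metrics_def by blast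
  have "A = A_coord e J l"
  proof (rule PiE_ext[of _ J "\<lambda>_. UNIV" _ ])
    show "A \<in> J \<rightarrow>\<^sub>E UNIV" using A by auto
    show "A_coord e J l \<in> J \<rightarrow>\<^sub>E UNIV" by (auto simp: A_coord_def)
    fix t assume t: "t \<in> J"
    obtain i j k where ijk: "t = (i, j, k)" by (cases t)
    note t0 = t[unfolded ijk] note t' = cyc[OF t0]
    show "A t = A_coord e J l t"
      using t0 le[OF t'(3)] le[OF t'(4)] le[OF t'(5)] h[OF t0] h[OF t'(1)] h[OF t'(2)]
      by (simp add: ijk A_coord_def)
  qed
  then show "A \<in> Euc T e J" using lT by (auto simp: Euc_def)
qed

end

theory Submission imports Defs begin

text \<open>
  Heron's formula in the coordinates \<open>A\<^sub>i\<^sub>j\<^sub>k\<close> is strictly increasing in each of them. So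
  if \<open>B \<le> A\<close> holds for all coordinates and both metrics have area 1, then \<open>A = B\<close>. This gives
  nonnegativity and definiteness of \<open>\<eta>\<close>.
\<close>

lemma heron_mono:
  fixes x y z x' y' z' :: real
  assumes "0 < x" "x \<le> x'" "0 < y" "y \<le> y'" "0 < z" "z \<le> z'"
  shows "(x + y + z) * x * y * z \<le> (x' + y' + z') * x' * y' * z'"
  using assms by (intro mult_mono add_mono) auto

text \<open>The product \<open>x * y * z\<close> is positive and does not decrease, so a strict
  increase of the factor \<open>x + y + z\<close> would make the whole expression strictly larger.
  Hence the two sums agree, and a termwise inequality between equal sums is an equality in each
  term.\<close>

lemma heron_eq_imp:
  fixes x y z x' y' z' :: real
  assumes "0 < x" "x \<le> x'" "0 < y" "y \<le> y'" "0 < z" "z \<le> z'"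
    and eq: "(x + y + z) * x * y * z = (x' + y' + z') * x' * y' * z'"
  shows "x = x' \<and> y = y' \<and> z = z'"
proof -
  have p: "x * y * z \<le> x' * y' * z'"
    using assms(1-6) by (intro mult_mono) auto
  have "\<not> x + y + z < x' + y' + z'"
  proof
    assume "x + y + z < x' + y' + z'"
    then have "(x + y + z) * (x * y * z) < (x' + y' + z') * (x' * y' * z')"
      using p assms(1-6) by (intro mult_less_le_imp_less) auto
    then show False using eq by (simp add: mult.assoc)
  qed
  then show ?thesis using assms(2,4,6) by linarith
qed

lemma finite_edge_triples:
  assumes "finite T" "bij_betw e I (edges T)" "edge_triples T e I J"
  shows "finite J"
proof -
  have "finite (edges T)" using assms(1) by (simp add: edges_def)
  then have "finite I" using assms(2) bij_betw_finite by blast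
  moreover have "J \<subseteq> I \<times> I \<times> I" using assms(3) by (simp add: edge_triples_def)
  ultimately show ?thesis by (simp add: finite_subset[of J])
qed

text \<open>Gives \<open>face_area_eq\<close> an explicit triple, so that the choice hidden in
  \<open>face_area\<close> can be replaced by Heron's formula.\<close>

lemma triple_of_face_edges:
  assumes e: "bij_betw e I (edges T)" and J: "edge_triples T e I J" and f: "f \<in> T"
  obtains i j k where "(i, j, k) \<in> J" "face_edges f = {# e i, e j, e k #}"
proof -
  obtain a b c where abc: "face_edges f = {# a, b, c #}" by (auto simp: face_edges_def)
  have "a \<in> edges T" "b \<in> edges T" "c \<in> edges T"
    using abc f unfolding edges_def by force+
  then obtain p q r where pqr: "p \<in> I" "q \<in> I" "r \<in> I" "a = e p" "b = e q" "c = e r"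
    using e unfolding bij_betw_def by (metis imageE)
  then obtain i j k where t: "(i, j, k) \<in> J" and m: "{# i, j, k #} = {# p, q, r #}"
    using triple_of_face[OF J f] abc by metis
  \<comment> \<open>\<open>J\<close> may list the indices in another order than \<open>p\<close>,
    \<open>q\<close>, \<open>r\<close>; as multisets of edges the two triples still agree.\<close>
  have "face_edges f = image_mset e {# p, q, r #}" using abc pqr by simp
  also have "\<dots> = {# e i, e j, e k #}" unfolding m[symmetric] by simp
  finally show ?thesis using that t by blast
qed

text \<open>Every triple of \<open>J\<close> comes from a face, and twice the coordinate is the
  slack in one of the strict triangle inequalities of that face.\<close>

lemma Euc_pos:
  assumes J: "edge_triples T e I J" and A: "A \<in> Euc T e J" and t: "t \<in> J"
  shows "0 < A t"
proof -
  obtain l where l: "l \<in> adapted_metrics T" "A = A_coord e J l" using A by (auto simp: Euc_def)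
  obtain i j k where ijk: "t = (i, j, k)" by (cases t)
  obtain f where f: "f \<in> T" "face_edges f = {# e i, e j, e k #}"
    using face_of_triple[OF J t[unfolded ijk]] by metis
  then have "l (e i) < l (e j) + l (e k)" using l(1) unfolding adapted_metrics_def by blast
  then show ?thesis using t by (simp add: l(2) A_coord_def ijk)
qed

lemma Euc_extensional: "A \<in> Euc T e J \<Longrightarrow> A \<in> extensional J"
  by (auto simp: Euc_def A_coord_def)

lemma face_area_mono:
  assumes e: "bij_betw e I (edges T)" and J: "edge_triples T e I J"
    and A: "A \<in> Euc T e J" and B: "B \<in> Euc T e J"
    and le: "\<And>t. t \<in> J \<Longrightarrow> B t \<le> A t" and f: "f \<in> T"
  shows "face_area e J B f \<le> face_area e J A f"
proof -
  have inj: "inj_on e I" using e by (simp add: bij_betw_def)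
  obtain i j k where t: "(i, j, k) \<in> J" "face_edges f = {# e i, e j, e k #}"
    using triple_of_face_edges[OF e J f] .
  have "(j, k, i) \<in> J" "(k, i, j) \<in> J" using J t(1) by (auto simp: edge_triples_def)
  then show ?thesis
    \<comment> \<open>The same triple computes the area of the face for both metrics, which reduces
      the claim to a comparison of radicands.\<close>
    unfolding face_area_eq[OF J inj t] using t(1)
    by (intro real_sqrt_le_mono heron_mono Euc_pos[OF J B] le)
qed

text \<open>One coordinate suffices in the conclusion, since the triple can be rotated to start at
  any edge of the face.\<close>

lemma face_area_eq_imp:
  assumes e: "bij_betw e I (edges T)" and J: "edge_triples T e I J"
    and A: "A \<in> Euc T e J" and B: "B \<in> Euc T e J"
    and le: "\<And>t. t \<in> J \<Longrightarrow> B t \<le> A t"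
    and t: "(i, j, k) \<in> J" "face_edges f = {# e i, e j, e k #}"
    and eq: "face_area e J B f = face_area e J A f"
  shows "B (i, j, k) = A (i, j, k)"
proof -
  have inj: "inj_on e I" using e by (simp add: bij_betw_def)
  have t': "(j, k, i) \<in> J" "(k, i, j) \<in> J" using J t(1) by (auto simp: edge_triples_def)
  note pos = Euc_pos[OF J B]
  have "(B (i, j, k) + B (j, k, i) + B (k, i, j)) * B (i, j, k) * B (j, k, i) * B (k, i, j)
    = (A (i, j, k) + A (j, k, i) + A (k, i, j)) * A (i, j, k) * A (j, k, i) * A (k, i, j)"
    using eq unfolding face_area_eq[OF J inj t] by simp
  from heron_eq_imp[OF pos[OF t(1)] le[OF t(1)] pos[OF t'(1)] le[OF t'(1)]
      pos[OF t'(2)] le[OF t'(2)] this]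
  show ?thesis by blast
qed

lemma Euc1_le_imp_eq:
  assumes fin: "finite T" and e: "bij_betw e I (edges T)" and J: "edge_triples T e I J"
    and A: "A \<in> Euc1 T e J" and B: "B \<in> Euc1 T e J"
    and le: "\<And>t. t \<in> J \<Longrightarrow> B t \<le> A t"
  shows "A = B"
proof (rule extensionalityI)
  have AB: "A \<in> Euc T e J" "B \<in> Euc T e J" "Ar T e J B = Ar T e J A"
    using A B by (auto simp: Euc1_def)
  show "A \<in> extensional J" "B \<in> extensional J" using AB Euc_extensional by blast+
  fix t assume "t \<in> J"
  moreover obtain i j k where ijk: "t = (i, j, k)" by (cases t)
  ultimately have t: "(i, j, k) \<in> J" by simp
  then obtain f where f: "f \<in> T" "face_edges f = {# e i, e j, e k #}"
    using face_of_triple[OF J] by metis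
  \<comment> \<open>The areas of \<open>B\<close> are bounded face by face by those of
    \<open>A\<close>, and the totals are equal, so no single face can have strictly smaller
    area.\<close>
  have "face_area e J B f = face_area e J A f"
    using sum_mono_inv[OF AB(3)[unfolded Ar_def] _ f(1) fin]
      face_area_mono[OF e J AB(1,2) le] by blast
  then show "A t = B t"
    using face_area_eq_imp[OF e J AB(1,2) le t f(2)] by (simp add: ijk)
qed

text \<open>Without faces the area would be an empty sum, hence 0 instead of 1. This ensures that
  the maximum in \<open>eta\<close> is taken over a nonempty set.\<close>

lemma Euc1_nonempty_imp:
  assumes "bij_betw e I (edges T)" "edge_triples T e I J" "A \<in> Euc1 T e J"
  shows "J \<noteq> {}"
proof -
  have "Ar T e J A \<noteq> 0" using assms(3) by (simp add: Euc1_def)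
  then obtain f where "f \<in> T" unfolding Ar_def by (metis sum.neutral)
  then show ?thesis using triple_of_face_edges[OF assms(1,2)] by (metis empty_iff)
qed

theorem proposition4p3:
  fixes S :: "'a topology"
    and T :: "(complex \<Rightarrow> 'a) set"
    and I :: "'i set"
    and e :: "'i \<Rightarrow> 'a set"
    and J :: "('i \<times> 'i \<times> 'i) set"
  assumes "compact_surface S"
    and "surface_triangulation S T"
    and "bij_betw e I (edges T)"
    and "edge_triples T e I J"
  shows "(\<forall>A \<in> Euc1 T e J. \<forall>B \<in> Euc1 T e J. 0 \<le> eta J A B) \<and>
    (\<forall>A \<in> Euc1 T e J. \<forall>B \<in> Euc1 T e J. eta J A B = 0 \<longleftrightarrow> A = B) \<and>
    (\<forall>A \<in> Euc1 T e J. \<forall>B \<in> Euc1 T e J. \<forall>D \<in> Euc1 T e J.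
       eta J A D \<le> eta J A B + eta J B D)"
proof -
  note e = assms(3) and J = assms(4)
  have finT: "finite T" using assms(2) by (simp add: surface_triangulation_def)
  have finJ: "finite J" using finite_edge_triples[OF finT e J] .
  \<comment> \<open>The claims are proved in multiplicative form for the maximal ratio
    \<open>M\<close>: it is at least 1, equals 1 exactly on the diagonal, and is submultiplicative.
    Taking \<open>ln\<close> then gives the three properties of \<open>eta\<close>.\<close>
  define M where "M = (\<lambda>A B :: 'i \<times> 'i \<times> 'i \<Rightarrow> real. Max ((\<lambda>t. B t / A t) ` J))"
  have eta: "eta J A B = ln (M A B)" for A B by (simp add: eta_def M_def)
  have pos: "0 < A t" if "A \<in> Euc1 T e J" "t \<in> J" for A t
    using Euc_pos[OF J _ that(2)] that(1) by (simp add: Euc1_def)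
  have ub: "B t / A t \<le> M A B" if "t \<in> J" for A B t
    unfolding M_def using finJ that by simp
  have M_pos: "0 < M A B" if "A \<in> Euc1 T e J" "B \<in> Euc1 T e J" for A B
  proof -
    have "J \<noteq> {}" using Euc1_nonempty_imp[OF e J that(1)] .
    then obtain t where t: "t \<in> J" by blast
    then have "0 < B t / A t" using pos that by simp
    then show ?thesis using ub[OF t] by (rule less_le_trans)
  qed
  have M_self: "M A A = 1" if "A \<in> Euc1 T e J" for A
  proof -
    have "(\<lambda>t. A t / A t) ` J = (\<lambda>t. 1) ` J" using pos[OF that] by (intro image_cong) force+
    also have "\<dots> = {1}" using Euc1_nonempty_imp[OF e J that] by auto
    finally show ?thesis by (simp only: M_def Max_singleton)
  qed
  have eq: "A = B" if AB: "A \<in> Euc1 T e J" "B \<in> Euc1 T e J" and "M A B \<le> 1" for A B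
  proof (rule Euc1_le_imp_eq[OF finT e J AB])
    fix t assume t: "t \<in> J"
    have "B t / A t \<le> 1" using ub[OF t, of B A] that(3) by linarith
    then show "B t \<le> A t" using pos[OF AB(1) t] by simp
  qed
  have M_ge: "1 \<le> M A B" if "A \<in> Euc1 T e J" "B \<in> Euc1 T e J" for A B
    \<comment> \<open>If \<open>M A B < 1\<close>, then \<open>eq\<close> forces
      \<open>A = B\<close>, contradicting \<open>M A A = 1\<close>.\<close>
    using eq[OF that] M_self[OF that(1)] by fastforce
  have tri: "M A D \<le> M A B * M B D"
    if "A \<in> Euc1 T e J" "B \<in> Euc1 T e J" "D \<in> Euc1 T e J" for A B D
  proof -
    have "D t / A t \<le> M A B * M B D" if t: "t \<in> J" for t
    proof -
      note p = pos[OF \<open>A \<in> Euc1 T e J\<close> t] pos[OF \<open>B \<in> Euc1 T e J\<close> t] pos[OF \<open>D \<in> Euc1 T e J\<close> t]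
      \<comment> \<open>The ratio factors through \<open>B\<close>; both factors are positive, so
        each may be bounded by its own maximum.\<close>
      have "D t / A t = (B t / A t) * (D t / B t)" using p by simp
      also have "\<dots> \<le> M A B * M B D"
        using ub[OF t] p M_pos[OF \<open>A \<in> Euc1 T e J\<close> \<open>B \<in> Euc1 T e J\<close>]
        by (intro mult_mono) (auto intro: less_imp_le)
      finally show ?thesis .
    qed
    then show ?thesis
      using finJ Euc1_nonempty_imp[OF e J that(1)] by (subst M_def) simp
  qed
  show ?thesis
  proof (intro conjI ballI)
    fix A B assume AB: "A \<in> Euc1 T e J" "B \<in> Euc1 T e J"
    show "0 \<le> eta J A B" using M_ge[OF AB] by (simp add: eta)
    show "eta J A B = 0 \<longleftrightarrow> A = B"
      using eq[OF AB] M_self[OF AB(1)] M_pos[OF AB] by (auto simp: eta)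
    fix D assume D: "D \<in> Euc1 T e J"
    \<comment> \<open>Monotonicity of \<open>ln\<close> uses that \<open>M A D\<close> is
      positive.\<close>
    have "ln (M A D) \<le> ln (M A B * M B D)"
      using tri[OF AB D] M_pos[OF AB(1) D] by simp
    also have "\<dots> = ln (M A B) + ln (M B D)"
      using M_pos[OF AB] M_pos[OF AB(2) D] by (simp add: ln_mult)
    finally show "eta J A D \<le> eta J A B + eta J B D" by (simp add: eta)
  qed
qed

end
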